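(* Let $A,B>0$ be bounded linear operators on a Hilbert space $\mathcal{H}$, let $m,m',M,M'>0$ be scalars, and let $v\in[0,1]$. (i) If $0<m'I\le A\le mI<MI\le B\le M'I$, then $$\frac{m'!_vM'}{m'\sharp_vM'}\,A\sharp_vB\le A!_vB\le\frac{m!_vM}{m\sharp_vM}\,A\sharp_vB.$$ (ii) If $0<m'I\le B\le mI<MI\le A\le M'I$, then $$\frac{M'!_vm'}{M'\sharp_vm'}\,A\sharp_vB\le A!_vB\le\frac{M!_vm}{M\sharp_vm}\,A\sharp_vB.$$
   Context: Operators are bounded linear operators on a Hilbert space $\mathcal{H}$ with identity $I$. $A\ge 0$ (positive) means $\langle Ax,x\rangle\ge 0$ for all $x\in\mathcal{H}$; $A>0$ (strictly positive) means $A$ is positive and invertible; for self-adjoint $A,B$, $A\le B$ means $B-A\ge 0$; $mI<MI$ means $m<M$. For $A,B>0$ and $v\in[0,1]$: $A\sharp_v B=A^{1/2}\left(A^{-1/2}BA^{-1/2}\right)^v A^{1/2}$ (powers by the continuous functional calculus) and $A!_vB=\left\{(1-v)A^{-1}+vB^{-1}\right\}^{-1}$. For scalars $a,b>0$: $a\sharp_v b=a^{1-v}b^v$ and $a!_vb=\left\{(1-v)a^{-1}+vb^{-1}\right\}^{-1}$. *)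

theory Defs
  imports "HOL-Analysis.Analysis" "HOL-Computational_Algebra.Polynomial"
begin

text \<open>
  A complex inner product space, linear in the first argument. It extends the class
  \<open>real_inner\<close> of its underlying real inner product space, which supplies norm and topology;
  positive definiteness of \<open>cinner\<close> is inherited through \<open>inner_eq_Re_cinner\<close>, and
  \<open>1 *\<^sub>C x = x\<close> through \<open>scaleR_scaleC\<close>.
\<close>

class complex_inner = real_inner +
  fixes scaleC :: "complex \<Rightarrow> 'a \<Rightarrow> 'a" (infixr "*\<^sub>C" 75)
    and cinner :: "'a \<Rightarrow> 'a \<Rightarrow> complex"
  assumes scaleC_add_right: "c *\<^sub>C (x + y) = c *\<^sub>C x + c *\<^sub>C y"
    and scaleC_add_left: "(c + d) *\<^sub>C x = c *\<^sub>C x + d *\<^sub>C x"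
    and scaleC_scaleC: "c *\<^sub>C d *\<^sub>C x = (c * d) *\<^sub>C x"
    and scaleR_scaleC: "r *\<^sub>R x = complex_of_real r *\<^sub>C x"
    and cinner_commute: "cinner x y = cnj (cinner y x)"
    and cinner_add_left: "cinner (x + y) z = cinner x z + cinner y z"
    and cinner_scaleC_left: "cinner (c *\<^sub>C x) y = c * cinner x y"
    and inner_eq_Re_cinner: "inner x y = Re (cinner x y)"

class chilbert_space = complex_inner + complete_space
begin

subclass banach ..

end

instantiation complex :: chilbert_space
begin

definition scaleC_complex :: "complex \<Rightarrow> complex \<Rightarrow> complex"
  where "scaleC_complex c x = c * x"

definition cinner_complex :: "complex \<Rightarrow> complex \<Rightarrow> complex"
  where "cinner_complex x y = x * cnj y"

instance
  by standard
    (simp_all add: scaleC_complex_def cinner_complex_def ring_distribs scaleR_conv_of_real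
      inner_complex_def mult.commute mult.assoc)

end

lemma norm_scaleC: "norm (c *\<^sub>C x) = cmod c * norm (x :: 'a :: complex_inner)"
proof -
  have right: "cinner y (c *\<^sub>C z) = cnj c * cinner y z" for y z :: 'a
    by (subst (1 2) cinner_commute) (simp only: cinner_scaleC_left complex_cnj_mult)
  have "cinner (c *\<^sub>C x) (c *\<^sub>C x) = (c * cnj c) * cinner x x"
    by (simp only: cinner_scaleC_left right ac_simps)
  also have "c * cnj c = complex_of_real ((cmod c)\<^sup>2)"
    by (simp only: complex_norm_square)
  finally have "cinner (c *\<^sub>C x) (c *\<^sub>C x) = complex_of_real ((cmod c)\<^sup>2) * cinner x x" .
  then have "inner (c *\<^sub>C x) (c *\<^sub>C x) = (cmod c)\<^sup>2 * inner x x"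
    by (simp add: inner_eq_Re_cinner)
  then show ?thesis
    by (simp add: norm_eq_sqrt_inner real_sqrt_mult)
qed

text \<open>
  Operators are elements of \<open>'a \<Rightarrow>\<^sub>L 'a\<close> that are moreover complex linear.
\<close>

definition complex_linear :: "('a :: chilbert_space \<Rightarrow>\<^sub>L 'a) \<Rightarrow> bool"
  where "complex_linear A \<longleftrightarrow> (\<forall>c x. A (c *\<^sub>C x) = c *\<^sub>C A x)"

lift_definition scaleC_id :: "complex \<Rightarrow> ('a :: chilbert_space \<Rightarrow>\<^sub>L 'a)"
  is "\<lambda>c x. c *\<^sub>C x"
proof (rule bounded_linear_intro)
  fix c :: complex and x y :: 'a and r :: real
  show "c *\<^sub>C (x + y) = c *\<^sub>C x + c *\<^sub>C y"
    by (rule scaleC_add_right)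
  show "c *\<^sub>C r *\<^sub>R x = r *\<^sub>R c *\<^sub>C x"
    by (simp add: scaleR_scaleC scaleC_scaleC mult.commute)
  show "norm (c *\<^sub>C x) \<le> norm x * cmod c"
    by (simp add: norm_scaleC mult.commute)
qed

definition positive_op :: "('a :: chilbert_space \<Rightarrow>\<^sub>L 'a) \<Rightarrow> bool"
  where "positive_op A \<longleftrightarrow> complex_linear A \<and> (\<forall>x. cinner (A x) x \<in> \<real>\<^sub>\<ge>\<^sub>0)"

definition selfadjoint_op :: "('a :: chilbert_space \<Rightarrow>\<^sub>L 'a) \<Rightarrow> bool"
  where "selfadjoint_op A \<longleftrightarrow> complex_linear A \<and> (\<forall>x y. cinner (A x) y = cinner x (A y))"

definition op_le :: "('a :: chilbert_space \<Rightarrow>\<^sub>L 'a) \<Rightarrow> ('a \<Rightarrow>\<^sub>L 'a) \<Rightarrow> bool"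
    (infix "\<preceq>" 50)
  where "A \<preceq> B \<longleftrightarrow> selfadjoint_op A \<and> selfadjoint_op B \<and> positive_op (B - A)"

definition invertible_op :: "('a :: chilbert_space \<Rightarrow>\<^sub>L 'a) \<Rightarrow> bool"
  where "invertible_op A \<longleftrightarrow> (\<exists>T. A o\<^sub>L T = id_blinfun \<and> T o\<^sub>L A = id_blinfun)"

definition inverse_op :: "('a :: chilbert_space \<Rightarrow>\<^sub>L 'a) \<Rightarrow> ('a \<Rightarrow>\<^sub>L 'a)"
  where "inverse_op A = (THE T. A o\<^sub>L T = id_blinfun \<and> T o\<^sub>L A = id_blinfun)"

definition strictly_positive_op :: "('a :: chilbert_space \<Rightarrow>\<^sub>L 'a) \<Rightarrow> bool"
  where "strictly_positive_op A \<longleftrightarrow> positive_op A \<and> invertible_op A"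

definition op_spectrum :: "('a :: chilbert_space \<Rightarrow>\<^sub>L 'a) \<Rightarrow> complex set"
  where "op_spectrum A = {c. \<not> invertible_op (scaleC_id c - A)}"

definition op_power :: "('a :: chilbert_space \<Rightarrow>\<^sub>L 'a) \<Rightarrow> nat \<Rightarrow> ('a \<Rightarrow>\<^sub>L 'a)"
  where "op_power A n = ((\<lambda>T. A o\<^sub>L T) ^^ n) id_blinfun"

definition op_poly :: "real poly \<Rightarrow> ('a :: chilbert_space \<Rightarrow>\<^sub>L 'a) \<Rightarrow> ('a \<Rightarrow>\<^sub>L 'a)"
  where "op_poly p A = (\<Sum>i\<le>degree p. coeff p i *\<^sub>R op_power A i)"

text \<open>
  For selfadjoint \<open>A\<close> (whose spectrum is real) and real \<open>f\<close> continuous on the spectrum,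
  \<open>f(A)\<close> is the norm limit of \<open>p\<^sub>n(A)\<close> for any polynomials \<open>p\<^sub>n\<close> converging to \<open>f\<close> uniformly on
  the spectrum. The value is meaningless for other \<open>A\<close> or \<open>f\<close>.
\<close>

definition op_fun :: "(real \<Rightarrow> real) \<Rightarrow> ('a :: chilbert_space \<Rightarrow>\<^sub>L 'a) \<Rightarrow> ('a \<Rightarrow>\<^sub>L 'a)"
  where "op_fun f A = (THE T. \<forall>p :: nat \<Rightarrow> real poly.
    uniform_limit {t. complex_of_real t \<in> op_spectrum A} (\<lambda>n. poly (p n)) f sequentially
      \<longrightarrow> (\<lambda>n. op_poly (p n) A) \<longlonglongrightarrow> T)"

definition op_powr :: "('a :: chilbert_space \<Rightarrow>\<^sub>L 'a) \<Rightarrow> real \<Rightarrow> ('a \<Rightarrow>\<^sub>L 'a)"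
  where "op_powr A r = op_fun (\<lambda>t. t powr r) A"

definition op_geo_mean ::
    "real \<Rightarrow> ('a :: chilbert_space \<Rightarrow>\<^sub>L 'a) \<Rightarrow> ('a \<Rightarrow>\<^sub>L 'a) \<Rightarrow> ('a \<Rightarrow>\<^sub>L 'a)"
  where "op_geo_mean v A B =
    op_powr A (1/2) o\<^sub>L
      op_powr (op_powr A (- (1/2)) o\<^sub>L B o\<^sub>L op_powr A (- (1/2))) v o\<^sub>L
    op_powr A (1/2)"

definition op_harm_mean ::
    "real \<Rightarrow> ('a :: chilbert_space \<Rightarrow>\<^sub>L 'a) \<Rightarrow> ('a \<Rightarrow>\<^sub>L 'a) \<Rightarrow> ('a \<Rightarrow>\<^sub>L 'a)"
  where "op_harm_mean v A B = inverse_op ((1 - v) *\<^sub>R inverse_op A + v *\<^sub>R inverse_op B)"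

definition geo_mean :: "real \<Rightarrow> real \<Rightarrow> real \<Rightarrow> real"
  where "geo_mean v a b = a powr (1 - v) * b powr v"

definition harm_mean :: "real \<Rightarrow> real \<Rightarrow> real \<Rightarrow> real"
  where "harm_mean v a b = inverse ((1 - v) * inverse a + v * inverse b)"

end

theory Submission
  imports Defs "HOL-Computational_Algebra.Fundamental_Theorem_Algebra"
begin

text \<open>
  Put \<open>X = A^(-1/2) B A^(-1/2)\<close>. Conjugating with \<open>A^(-1/2)\<close> turns the weighted geometric and harmonic
  means of \<open>A\<close> and \<open>B\<close> into the functions \<open>X^v\<close> and \<open>h(X)\<close> of the single operator \<open>X\<close>, where
  \<open>h t\<close> is the weighted harmonic mean of \<open>1\<close> and \<open>t\<close>. The bounds on \<open>A\<close> and \<open>B\<close> confine the spectrum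
  of \<open>X\<close> to \<open>[M / m, M' / m']\<close> in the first case and to \<open>[m' / M', m / M]\<close> in the second, and there
  the inequalities are statements about the real function
  \<open>t^v / h t = (1 - v) t^v + v t^(v - 1)\<close>, called \<open>mean_ratio\<close> below. It increases on
  \<open>[1, \<infinity>)\<close> and decreases on \<open>(0, 1]\<close>, so its extreme values over the interval sit at the end
  points; these values are the reciprocals of the constants in the theorem. The reduction is
  \<open>op_harm_mean_bounds\<close>, the monotonicity \<open>mean_ratio_mono\<close> and \<open>mean_ratio_antimono\<close>.

  The substance is the continuous functional calculus of a selfadjoint operator, which rests on
  the bound \<open>norm_op_poly_le\<close>: the norm of \<open>p(A)\<close> does not exceed the supremum of \<open>\<bar>p\<bar>\<close> on the
  spectrum of \<open>A\<close>. It is obtained over the reals. For selfadjoint \<open>S\<close> the operator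
  \<open>\<parallel>S\<parallel>\<^sup>2 - S\<^sup>2\<close> is not invertible unless \<open>S = 0\<close> (\<open>not_invertible_norm_square\<close>); with \<open>S = p(A)\<close> this
  is a polynomial in \<open>A\<close>, and a polynomial in \<open>A\<close> that is not invertible must vanish somewhere on
  the spectrum (\<open>invertible_op_poly\<close>). The bound makes \<open>p \<mapsto> p(A)\<close> extend to uniform limits of
  polynomials, hence to all continuous functions, and the extension is multiplicative and
  monotone.
\<close>

section \<open>Selfadjoint operators\<close>

text \<open>
  The imaginary part of the complex inner product is again a real inner product. A complex linear
  operator is therefore selfadjoint as soon as it is symmetric for the real inner product, and all
  order questions below can be settled with \<open>inner\<close> alone.
\<close>

lemma Im_cinner: "Im (cinner x y) = inner x (\<i> *\<^sub>C y)" for x y :: "'a :: chilbert_space"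
proof -
  have "cinner x (\<i> *\<^sub>C y) = cnj \<i> * cinner x y"
    by (subst (1 2) cinner_commute) (simp only: cinner_scaleC_left complex_cnj_mult)
  then show ?thesis
    by (simp add: inner_eq_Re_cinner)
qed

lemma selfadjoint_op_iff_inner:
  "selfadjoint_op A \<longleftrightarrow> complex_linear A \<and> (\<forall>x y. inner (A x) y = inner x (A y))"
  unfolding selfadjoint_op_def complex_linear_def complex_eq_iff Im_cinner
  by (auto simp: inner_eq_Re_cinner[symmetric])

lemma selfadjoint_op_inner: "selfadjoint_op A \<Longrightarrow> inner (A x) y = inner x (A y)"
  by (simp add: selfadjoint_op_iff_inner)

lemma positive_op_selfadjoint_iff:
  assumes "selfadjoint_op A"
  shows "positive_op A \<longleftrightarrow> (\<forall>x. 0 \<le> inner (A x) x)"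
proof -
  have "Im (cinner (A x) x) = 0" for x
  proof -
    have "cinner (A x) x = cnj (cinner (A x) x)"
      using assms cinner_commute[of "A x" x] by (simp add: selfadjoint_op_def)
    then show ?thesis
      by (simp add: complex_eq_iff)
  qed
  then show ?thesis
    using assms
    by (auto simp: positive_op_def selfadjoint_op_def inner_eq_Re_cinner complex_nonneg_Reals_iff)
qed

lemma selfadjoint_op_id [simp]: "selfadjoint_op id_blinfun"
  by (simp add: selfadjoint_op_iff_inner complex_linear_def)

lemma selfadjoint_op_zero [simp]: "selfadjoint_op 0"
proof -
  have "c *\<^sub>C 0 = (0 :: 'a)" for c
    using norm_scaleC[of c "0 :: 'a"] by simp
  then show ?thesis
    by (simp add: selfadjoint_op_iff_inner complex_linear_def)
qed

lemma selfadjoint_op_scaleR: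
  assumes "selfadjoint_op A"
  shows "selfadjoint_op (r *\<^sub>R A)"
proof -
  have "r *\<^sub>R c *\<^sub>C y = c *\<^sub>C r *\<^sub>R y" for c and y :: 'a
    by (simp only: scaleR_scaleC scaleC_scaleC mult.commute)
  with assms show ?thesis
    by (simp add: selfadjoint_op_iff_inner complex_linear_def scaleR_blinfun.rep_eq)
qed

lemma selfadjoint_op_add: "selfadjoint_op A \<Longrightarrow> selfadjoint_op B \<Longrightarrow> selfadjoint_op (A + B)"
  by (simp add: selfadjoint_op_iff_inner complex_linear_def plus_blinfun.rep_eq scaleC_add_right
      inner_add_left inner_add_right)

lemma selfadjoint_op_diff: "selfadjoint_op A \<Longrightarrow> selfadjoint_op B \<Longrightarrow> selfadjoint_op (A - B)"
  using selfadjoint_op_add[OF _ selfadjoint_op_scaleR[of B "-1"], of A] by simp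

lemma selfadjoint_op_compose_commute:
  assumes "selfadjoint_op A" "selfadjoint_op B" "A o\<^sub>L B = B o\<^sub>L A"
  shows "selfadjoint_op (A o\<^sub>L B)"
proof -
  have "A (B x) = B (A x)" for x
    using assms(3) by (metis blinfun_apply_blinfun_compose)
  then show ?thesis
    using assms(1,2) by (simp add: selfadjoint_op_iff_inner complex_linear_def)
qed

lemma selfadjoint_op_sandwich:
  "selfadjoint_op P \<Longrightarrow> selfadjoint_op A \<Longrightarrow> selfadjoint_op (P o\<^sub>L A o\<^sub>L P)"
  by (simp add: selfadjoint_op_iff_inner complex_linear_def)

lemma selfadjoint_op_limit:
  fixes A :: "nat \<Rightarrow> 'a :: chilbert_space \<Rightarrow>\<^sub>L 'a"
  assumes "\<And>n. selfadjoint_op (A n)" and lim: "A \<longlonglongrightarrow> T"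
  shows "selfadjoint_op T"
proof -
  have pt: "(\<lambda>n. A n x) \<longlonglongrightarrow> T x" for x
    using lim by (intro tendsto_intros)
  have "T (c *\<^sub>C x) = c *\<^sub>C T x" for c x
  proof (rule LIMSEQ_unique)
    show "(\<lambda>n. A n (c *\<^sub>C x)) \<longlonglongrightarrow> T (c *\<^sub>C x)"
      by (rule pt)
    have "(\<lambda>n. scaleC_id c (A n x)) \<longlonglongrightarrow> scaleC_id c (T x)"
      by (intro tendsto_intros pt)
    then show "(\<lambda>n. A n (c *\<^sub>C x)) \<longlonglongrightarrow> c *\<^sub>C T x"
      using assms(1) by (simp add: scaleC_id.rep_eq selfadjoint_op_def complex_linear_def)
  qed
  moreover have "inner (T x) y = inner x (T y)" for x y
  proof (rule LIMSEQ_unique)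
    show "(\<lambda>n. inner (A n x) y) \<longlonglongrightarrow> inner (T x) y"
      by (intro tendsto_intros pt)
    show "(\<lambda>n. inner (A n x) y) \<longlonglongrightarrow> inner x (T y)"
      unfolding selfadjoint_op_inner[OF assms(1)] by (intro tendsto_intros pt)
  qed
  ultimately show ?thesis
    by (simp add: selfadjoint_op_iff_inner complex_linear_def)
qed

lemma op_le_iff_inner:
  "A \<preceq> B \<longleftrightarrow> selfadjoint_op A \<and> selfadjoint_op B \<and> (\<forall>x. inner (A x) x \<le> inner (B x) x)"
  by (auto simp: op_le_def selfadjoint_op_diff positive_op_selfadjoint_iff minus_blinfun.rep_eq
      inner_diff_left)

text \<open>
  \<open>\<langle>PAPx, x\<rangle> = \<langle>A(Px), Px\<rangle>\<close>: this carries an inequality between functions of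
  \<open>A^(-1/2) B A^(-1/2)\<close> over to the operator means.
\<close>

lemma op_le_sandwich:
  assumes P: "selfadjoint_op P" and "A \<preceq> B"
  shows "P o\<^sub>L A o\<^sub>L P \<preceq> P o\<^sub>L B o\<^sub>L P"
  using assms
  by (simp add: op_le_iff_inner selfadjoint_op_sandwich selfadjoint_op_inner[OF P])

lemma op_le_trans: "A \<preceq> B \<Longrightarrow> B \<preceq> C \<Longrightarrow> A \<preceq> C"
  by (auto simp: op_le_iff_inner intro: order_trans)

lemma op_le_scaleR: "0 \<le> r \<Longrightarrow> A \<preceq> B \<Longrightarrow> r *\<^sub>R A \<preceq> r *\<^sub>R B"
  by (auto simp: op_le_iff_inner selfadjoint_op_scaleR scaleR_blinfun.rep_eq mult_left_mono)

section \<open>Invertible operators\<close>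

lemma invertible_op_id [simp]: "invertible_op id_blinfun"
  unfolding invertible_op_def by (intro exI[of _ id_blinfun]) (auto intro!: blinfun_eqI)

lemma inverse_op_eqI:
  assumes "A o\<^sub>L T = id_blinfun" "T o\<^sub>L A = id_blinfun"
  shows "inverse_op A = T"
  unfolding inverse_op_def
proof (rule the_equality)
  fix S assume S: "A o\<^sub>L S = id_blinfun \<and> S o\<^sub>L A = id_blinfun"
  have "S = S o\<^sub>L (A o\<^sub>L T)"
    using assms(1) by (auto intro: blinfun_eqI)
  also have "\<dots> = (S o\<^sub>L A) o\<^sub>L T"
    by (auto intro: blinfun_eqI)
  also have "\<dots> = T"
    using S by (auto intro: blinfun_eqI)
  finally show "S = T" .
qed (use assms in auto)

lemma invertible_op_compose:
  assumes "invertible_op A" "invertible_op B"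
  shows "invertible_op (A o\<^sub>L B)"
proof -
  obtain S T where "A o\<^sub>L S = id_blinfun" "S o\<^sub>L A = id_blinfun"
    "B o\<^sub>L T = id_blinfun" "T o\<^sub>L B = id_blinfun"
    using assms unfolding invertible_op_def by blast
  then have "A (S x) = x" "S (A x) = x" "B (T x) = x" "T (B x) = x" for x
    by (metis blinfun_apply_blinfun_compose blinfun_apply_id_blinfun id_apply)+
  then show ?thesis
    unfolding invertible_op_def by (intro exI[of _ "T o\<^sub>L S"]) (auto intro!: blinfun_eqI)
qed

lemma invertible_op_scaleR:
  assumes "invertible_op A" "r \<noteq> 0"
  shows "invertible_op (r *\<^sub>R A)"
proof -
  obtain T where "A o\<^sub>L T = id_blinfun" "T o\<^sub>L A = id_blinfun"
    using assms unfolding invertible_op_def by blast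
  then have "A (T x) = x" "T (A x) = x" for x
    by (metis blinfun_apply_blinfun_compose blinfun_apply_id_blinfun id_apply)+
  with \<open>r \<noteq> 0\<close> show ?thesis
    unfolding invertible_op_def
    by (intro exI[of _ "inverse r *\<^sub>R T"])
      (auto intro!: blinfun_eqI simp: scaleR_blinfun.rep_eq blinfun.scaleR_right)
qed

text \<open>
  The Lax--Milgram argument: for small \<open>\<tau> > 0\<close> the map \<open>x \<mapsto> x - \<tau> (S x - y)\<close> is a
  contraction, and its fixed point solves \<open>S x = y\<close>. The inverse is bounded because
  \<open>c \<parallel>x\<parallel> \<le> \<parallel>S x\<parallel>\<close>.
\<close>

lemma coercive_imp_invertible_op:
  fixes S :: "'a :: chilbert_space \<Rightarrow>\<^sub>L 'a"
  assumes c: "0 < c" and coercive: "\<And>x. c * (norm x)\<^sup>2 \<le> inner (S x) x"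
  shows "invertible_op S"
proof -
  have below: "c * norm x \<le> norm (S x)" for x
  proof (cases "x = 0")
    case False
    have "c * norm x * norm x \<le> norm (S x) * norm x"
      using coercive[of x] norm_cauchy_schwarz[of "S x" x] by (simp add: power2_eq_square)
    with False show ?thesis
      by simp
  qed simp
  have inj: "x = y" if "S x = S y" for x y
    using below[of "x - y"] c that
    by (simp add: blinfun.diff_right mult_le_0_iff)
  \<comment> \<open>Any bound \<open>K \<ge> \<parallel>S\<parallel>\<close> would do for the contraction; adding \<open>c\<close> keeps \<open>K\<close> positive and
    the squared contraction factor \<open>1 - (c / K)\<^sup>2\<close> nonnegative. The step \<open>c / K\<^sup>2\<close> minimises
    \<open>1 - 2 \<tau> c + \<tau>\<^sup>2 K\<^sup>2\<close>.\<close>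
  define K where "K = norm S + c"
  have K: "0 < K" "c \<le> K" "norm S \<le> K"
    using c by (auto simp: K_def add_nonneg_pos)
  define \<tau> where "\<tau> = c / K\<^sup>2"
  have \<tau>: "0 < \<tau>"
    using c K by (simp add: \<tau>_def)
  define q where "q = 1 - (c / K)\<^sup>2"
  have q: "0 \<le> q" "q < 1"
    using c K by (auto simp: q_def power_le_one)
  have contract: "(norm (z - \<tau> *\<^sub>R S z))\<^sup>2 \<le> q * (norm z)\<^sup>2" for z
  proof -
    have "norm (S z) \<le> K * norm z"
      using norm_blinfun[of S z] mult_right_mono[OF K(3), of "norm z"] by simp
    then have "(norm (S z))\<^sup>2 \<le> (K * norm z)\<^sup>2"
      by (intro power_mono) auto
    then have 1: "\<tau>\<^sup>2 * (norm (S z))\<^sup>2 \<le> \<tau>\<^sup>2 * (K * norm z)\<^sup>2"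
      by (intro mult_left_mono) auto
    have 2: "2 * \<tau> * (c * (norm z)\<^sup>2) \<le> 2 * \<tau> * inner (S z) z"
      using coercive[of z] \<tau> by (intro mult_left_mono) auto
    have "(norm (z - \<tau> *\<^sub>R S z))\<^sup>2 = (norm z)\<^sup>2 - 2 * \<tau> * inner (S z) z + \<tau>\<^sup>2 * (norm (S z))\<^sup>2"
      unfolding power2_norm_eq_inner
      by (simp add: inner_diff_left inner_diff_right inner_commute power2_eq_square algebra_simps)
    also have "\<dots> \<le> (norm z)\<^sup>2 - 2 * \<tau> * (c * (norm z)\<^sup>2) + \<tau>\<^sup>2 * (K * norm z)\<^sup>2"
      using 1 2 by linarith
    also have "\<dots> = q * (norm z)\<^sup>2"
      using K by (simp add: \<tau>_def q_def power2_eq_square field_simps)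
    finally show ?thesis .
  qed
  have surj: "\<exists>x. S x = y" for y
  proof -
    define f where "f x = x - \<tau> *\<^sub>R (S x - y)" for x
    have "dist (f x) (f x') \<le> sqrt q * dist x x'" for x x'
    proof -
      have "f x - f x' = (x - x') - \<tau> *\<^sub>R S (x - x')"
        by (simp add: f_def blinfun.diff_right algebra_simps)
      then have "(dist (f x) (f x'))\<^sup>2 \<le> (sqrt q * dist x x')\<^sup>2"
        using contract[of "x - x'"] q by (simp add: dist_norm power_mult_distrib)
      then show ?thesis
        by (rule power2_le_imp_le) (use q in simp)
    qed
    then obtain x where "f x = x"
      using banach_fix_type[of "sqrt q" f] q by auto
    then show ?thesis
      using \<tau> by (auto simp: f_def)
  qed
  define R where "R y = (SOME x. S x = y)" for y
  have SR: "S (R y) = y" for y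
    unfolding R_def using someI_ex[OF surj] .
  have "bounded_linear R"
  proof (rule bounded_linear_intro)
    show "R (x + y) = R x + R y" for x y
      by (rule inj) (simp add: SR blinfun.add_right)
    show "R (r *\<^sub>R x) = r *\<^sub>R R x" for r x
      by (rule inj) (simp add: SR blinfun.scaleR_right)
    show "norm (R y) \<le> norm y * (1 / c)" for y
      using below[of "R y"] c by (simp add: SR field_simps)
  qed
  then have R: "Blinfun R y = R y" for y
    by (simp add: bounded_linear_Blinfun_apply)
  have RS: "R (S x) = x" for x
    by (rule inj) (rule SR)
  have "S o\<^sub>L Blinfun R = id_blinfun" "Blinfun R o\<^sub>L S = id_blinfun"
    by (auto intro!: blinfun_eqI simp: R SR RS)
  then show ?thesis
    unfolding invertible_op_def by blast
qed

section \<open>Polynomials of an operator\<close>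

lemma op_power_Suc: "op_power A (Suc n) = A o\<^sub>L op_power A n"
  by (simp add: op_power_def)

lemma op_poly_altdef:
  assumes "degree p \<le> n"
  shows "op_poly p A = (\<Sum>i\<le>n. coeff p i *\<^sub>R op_power A i)"
  unfolding op_poly_def
  by (rule sum.mono_neutral_left) (use assms in \<open>auto simp: coeff_eq_0\<close>)

lemma op_poly_0 [simp]: "op_poly 0 A = 0"
  by (simp add: op_poly_def)

lemma op_poly_pCons: "op_poly (pCons a p) A = a *\<^sub>R id_blinfun + (A o\<^sub>L op_poly p A)"
proof -
  have "op_poly (pCons a p) A
      = (\<Sum>i\<le>Suc (degree p). coeff (pCons a p) i *\<^sub>R op_power A i)"
    by (rule op_poly_altdef) (rule degree_pCons_le)
  also have "\<dots> = a *\<^sub>R id_blinfun + (\<Sum>i\<le>degree p. coeff p i *\<^sub>R (A o\<^sub>L op_power A i))"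
    by (subst sum.atMost_Suc_shift) (simp add: op_power_Suc, simp add: op_power_def)
  also have "(\<Sum>i\<le>degree p. coeff p i *\<^sub>R (A o\<^sub>L op_power A i)) = A o\<^sub>L op_poly p A"
    by (simp add: op_poly_def bounded_bilinear.sum_right[OF bounded_bilinear_blinfun_compose]
        bounded_bilinear.scaleR_right[OF bounded_bilinear_blinfun_compose])
  finally show ?thesis .
qed

lemma op_poly_pCons_apply: "op_poly (pCons a p) A x = a *\<^sub>R x + A (op_poly p A x)"
  by (simp add: op_poly_pCons plus_blinfun.rep_eq scaleR_blinfun.rep_eq)

lemma op_poly_add: "op_poly (p + q) A = op_poly p A + op_poly q A"
proof -
  let ?n = "max (degree p) (degree q)"
  have "degree (p + q) \<le> ?n"
    by (rule degree_add_le_max)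
  then show ?thesis
    by (simp add: op_poly_altdef[of _ ?n] sum.distrib scaleR_add_left)
qed

lemma op_poly_smult: "op_poly (smult c p) A = c *\<^sub>R op_poly p A"
  using degree_smult_le[of c p]
  by (simp add: op_poly_altdef[of _ "degree p"] scaleR_sum_right)

lemma op_poly_diff: "op_poly (p - q) A = op_poly p A - op_poly q A"
  using op_poly_add[of p "smult (-1) q" A] op_poly_smult[of "-1" q A] by simp

lemma op_poly_mult: "op_poly (p * q) A = op_poly p A o\<^sub>L op_poly q A"
proof (induction p)
  case (pCons a p)
  then show ?case
    by (auto intro!: blinfun_eqI
        simp: op_poly_add op_poly_smult op_poly_pCons plus_blinfun.rep_eq scaleR_blinfun.rep_eq)
qed (auto intro!: blinfun_eqI simp: zero_blinfun.rep_eq)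

lemma op_poly_commute: "op_poly p A o\<^sub>L op_poly q A = op_poly q A o\<^sub>L op_poly p A"
  by (metis mult.commute op_poly_mult)

lemma selfadjoint_op_poly:
  assumes "selfadjoint_op A"
  shows "selfadjoint_op (op_poly p A)"
proof (induction p)
  case (pCons a p)
  have "A = op_poly [:0, 1:] A"
    by (auto intro!: blinfun_eqI
        simp: op_poly_pCons plus_blinfun.rep_eq zero_blinfun.rep_eq scaleR_blinfun.rep_eq)
  then have "A o\<^sub>L op_poly p A = op_poly p A o\<^sub>L A"
    using op_poly_commute by metis
  then show ?case
    using pCons assms
    by (simp add: op_poly_pCons selfadjoint_op_add selfadjoint_op_scaleR
        selfadjoint_op_compose_commute)
qed simp

section \<open>The real spectrum\<close>

abbreviation real_spectrum :: "('a :: chilbert_space \<Rightarrow>\<^sub>L 'a) \<Rightarrow> real set"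
  where "real_spectrum A \<equiv> {t. complex_of_real t \<in> op_spectrum A}"

lemma mem_real_spectrum_iff:
  fixes A :: "'a :: chilbert_space \<Rightarrow>\<^sub>L 'a"
  shows "t \<in> real_spectrum A \<longleftrightarrow> \<not> invertible_op (t *\<^sub>R id_blinfun - A)"
proof -
  have "scaleC_id (complex_of_real t) = t *\<^sub>R (id_blinfun :: 'a \<Rightarrow>\<^sub>L 'a)"
    by (rule blinfun_eqI) (simp add: scaleC_id.rep_eq scaleR_blinfun.rep_eq scaleR_scaleC)
  then show ?thesis
    by (simp add: op_spectrum_def)
qed

text \<open>
  Outside \<open>[a, b]\<close> one of \<open>A - t\<close> and \<open>t - A\<close> is coercive.
\<close>

lemma real_spectrum_subset:
  assumes lower: "a *\<^sub>R id_blinfun \<preceq> A" and upper: "A \<preceq> b *\<^sub>R id_blinfun"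
  shows "real_spectrum A \<subseteq> {a..b}"
proof
  fix t assume t: "t \<in> real_spectrum A"
  have bounds: "a * (norm x)\<^sup>2 \<le> inner (A x) x" "inner (A x) x \<le> b * (norm x)\<^sup>2" for x
    using lower upper by (auto simp: op_le_iff_inner scaleR_blinfun.rep_eq power2_norm_eq_inner)
  have "invertible_op (t *\<^sub>R id_blinfun - A)" if "b < t"
    by (rule coercive_imp_invertible_op[of "t - b"])
      (use that bounds in \<open>auto simp: minus_blinfun.rep_eq scaleR_blinfun.rep_eq inner_diff_left
        power2_norm_eq_inner left_diff_distrib\<close>)
  moreover have "invertible_op (t *\<^sub>R id_blinfun - A)" if "t < a"
  proof -
    have "invertible_op (A - t *\<^sub>R id_blinfun)"
      by (rule coercive_imp_invertible_op[of "a - t"])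
        (use that bounds in \<open>auto simp: minus_blinfun.rep_eq scaleR_blinfun.rep_eq inner_diff_left
          power2_norm_eq_inner left_diff_distrib\<close>)
    from invertible_op_scaleR[OF this, of "-1"] show ?thesis
      by simp
  qed
  ultimately show "t \<in> {a..b}"
    using t unfolding mem_real_spectrum_iff by force
qed

text \<open>
  A complex root \<open>z\<close> of \<open>q\<close> is either real or comes with its conjugate; in the second case
  \<open>(X - z) (X - cnj z)\<close> is a real quadratic dividing \<open>q\<close>.
\<close>

lemma real_poly_factor_cases:
  fixes q :: "real poly"
  assumes "degree q > 0"
  obtains (linear) a r where "q = [:- a, 1:] * r"
    | (quadratic) a b r where "b \<noteq> 0" "q = [:a\<^sup>2 + b\<^sup>2, - 2 * a, 1:] * r"
proof -
  let ?c = "map_poly complex_of_real"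
  have "degree (?c q) > 0"
    using assms by (simp add: degree_map_poly)
  then obtain z where z: "poly (?c q) z = 0"
    using fundamental_theorem_of_algebra[of "?c q"] constant_degree[of "?c q"] by auto
  \<comment> \<open>Evaluation of real polynomials at \<open>z\<close> is a ring homomorphism.\<close>
  have pC: "poly (?c (pCons a p)) z = of_real a + z * poly (?c p) z" for a p
    by (simp add: map_poly_pCons)
  have add: "poly (?c (p + r)) z = poly (?c p) z + poly (?c r) z" for p r
  proof (induction p arbitrary: r)
    case (pCons a p)
    then show ?case
      by (cases r) (simp add: pC algebra_simps)
  qed simp
  have smult: "poly (?c (smult a r)) z = of_real a * poly (?c r) z" for a r
    by (induction r) (auto simp: pC algebra_simps)
  have mult: "poly (?c (p * r)) z = poly (?c p) z * poly (?c r) z" for p r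
    by (induction p) (auto simp: pC add smult algebra_simps)
  show thesis
  proof (cases "Im z = 0")
    case True
    then have "z = complex_of_real (Re z)"
      by (simp add: complex_eq_iff)
    then have "poly (?c p) z = of_real (poly p (Re z))" for p
      by (induction p) (auto simp: pC)
    with z have "poly q (Re z) = 0"
      by simp
    then show ?thesis
      using linear by (auto simp: poly_eq_0_iff_dvd dvd_def)
  next
    case False
    define s where "s = [:(Re z)\<^sup>2 + (Im z)\<^sup>2, - 2 * Re z, 1:]"
    have "poly (?c s) z = 0"
      by (simp add: s_def pC complex_eq_iff power2_eq_square algebra_simps)
    moreover have "q = q div s * s + q mod s"
      by simp
    \<comment> \<open>The remainder has degree at most 1 and vanishes at the nonreal \<open>z\<close>, so it is zero.\<close>
    ultimately have rem: "poly (?c (q mod s)) z = 0"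
      using z by (metis add mult mult_zero_right add_0)
    have "s \<noteq> 0" "degree s = 2"
      by (simp_all add: s_def)
    then have "degree (q mod s) \<le> 1"
      using degree_mod_less[of s q] by auto
    moreover obtain c q' where c: "q mod s = pCons c q'"
      by (rule pCons_cases)
    ultimately have "degree q' = 0"
      by (auto split: if_splits)
    then obtain d where cd: "q mod s = [:c, d:]"
      using c degree_eq_zeroE by metis
    with rem have "of_real c + z * of_real d = (0 :: complex)"
      by (simp add: pC)
    then have "d = 0" "c = 0"
      using False by (auto simp: complex_eq_iff)
    with cd have "q = s * (q div s)"
      using mult_div_mod_eq[of s q] by simp
    with False show ?thesis
      using quadratic s_def by blast
  qed
qed

text \<open>
  One half of the spectral mapping theorem. In the real factorisation of \<open>q\<close>, a linear factor
  \<open>X - a\<close> gives an invertible operator because \<open>a\<close> is outside the spectrum, and a quadratic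
  factor gives \<open>(A - a)\<^sup>2 + b\<^sup>2\<close>, which is coercive because \<open>A\<close> is selfadjoint. That the spectrum
  of a selfadjoint operator is real is contained in the second case.
\<close>

lemma invertible_op_poly:
  assumes A: "selfadjoint_op A"
  shows "q \<noteq> 0 \<Longrightarrow> (\<And>t. t \<in> real_spectrum A \<Longrightarrow> poly q t \<noteq> 0) \<Longrightarrow> invertible_op (op_poly q A)"
proof (induction "degree q" arbitrary: q rule: less_induct)
  case less
  show ?case
  proof (cases "degree q = 0")
    case True
    then obtain c where "q = [:c:]" "c \<noteq> 0"
      using less.prems(1) by (metis degree_eq_zeroE pCons_0_0)
    then show ?thesis
      by (simp add: op_poly_pCons invertible_op_scaleR)
  next
    case False
    have step: "invertible_op (op_poly q A)"
      if q: "q = s * r" and deg: "degree s > 0" and s: "invertible_op (op_poly s A)" for s r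
    proof -
      have "s \<noteq> 0" "r \<noteq> 0"
        using less.prems(1) q by auto
      then have "degree r < degree q"
        using q deg by (simp add: degree_mult_eq)
      moreover have "poly r t \<noteq> 0" if "t \<in> real_spectrum A" for t
        using less.prems(2)[OF that] q by auto
      ultimately have "invertible_op (op_poly r A)"
        using less.hyps \<open>r \<noteq> 0\<close> by blast
      then show ?thesis
        using s by (simp add: q op_poly_mult invertible_op_compose)
    qed
    from False have "degree q > 0"
      by simp
    then show ?thesis
    proof (cases rule: real_poly_factor_cases)
      case (linear a r)
      have "poly q a = 0"
        by (simp add: linear)
      then have "invertible_op (a *\<^sub>R id_blinfun - A)"
        using less.prems(2) mem_real_spectrum_iff by blast
      then have "invertible_op ((-1) *\<^sub>R (a *\<^sub>R id_blinfun - A))"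
        by (rule invertible_op_scaleR) simp
      moreover have "(-1) *\<^sub>R (a *\<^sub>R id_blinfun - A) = op_poly [:- a, 1:] A"
        by (rule blinfun_eqI)
          (simp add: op_poly_pCons plus_blinfun.rep_eq minus_blinfun.rep_eq scaleR_blinfun.rep_eq
            uminus_blinfun.rep_eq zero_blinfun.rep_eq)
      ultimately show ?thesis
        by (intro step[OF linear]) simp_all
    next
      case (quadratic a b r)
      have "b\<^sup>2 * (norm x)\<^sup>2 \<le> inner (op_poly [:a\<^sup>2 + b\<^sup>2, - 2 * a, 1:] A x) x" for x
      proof -
        have "inner (op_poly [:a\<^sup>2 + b\<^sup>2, - 2 * a, 1:] A x) x
            = (norm (A x - a *\<^sub>R x))\<^sup>2 + b\<^sup>2 * (norm x)\<^sup>2"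
          unfolding power2_norm_eq_inner
          by (simp add: op_poly_pCons_apply inner_add_left inner_diff_left inner_diff_right
              blinfun.add_right blinfun.scaleR_right zero_blinfun.rep_eq
              selfadjoint_op_inner[OF A] inner_commute[of "A x" x] power2_eq_square algebra_simps)
        then show ?thesis
          by simp
      qed
      then have "invertible_op (op_poly [:a\<^sup>2 + b\<^sup>2, - 2 * a, 1:] A)"
        using quadratic(1) by (intro coercive_imp_invertible_op[of "b\<^sup>2"]) auto
      then show ?thesis
        by (intro step[OF quadratic(2)]) simp_all
    qed
  qed
qed

section \<open>The spectral bound\<close>

text \<open>
  For selfadjoint \<open>S\<close> with norm \<open>c\<close> one has
  \<open>\<parallel>(c\<^sup>2 - S\<^sup>2) x\<parallel>\<^sup>2 \<le> c\<^sup>2 (c\<^sup>2 \<parallel>x\<parallel>\<^sup>2 - \<parallel>S x\<parallel>\<^sup>2)\<close>. If \<open>c\<^sup>2 - S\<^sup>2\<close> were invertible, the left-hand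
  side would be at least a positive multiple of \<open>\<parallel>x\<parallel>\<^sup>2\<close>, so \<open>\<parallel>S x\<parallel>\<close> would stay below a constant
  smaller than \<open>c\<close> times \<open>\<parallel>x\<parallel>\<close>, against the definition of the norm.
\<close>

lemma not_invertible_norm_square:
  assumes S: "selfadjoint_op S" and inv: "invertible_op ((norm S)\<^sup>2 *\<^sub>R id_blinfun - (S o\<^sub>L S))"
  shows "S = 0"
proof -
  define c where "c = norm S"
  obtain R where R: "R o\<^sub>L (c\<^sup>2 *\<^sub>R id_blinfun - (S o\<^sub>L S)) = id_blinfun"
    using inv unfolding invertible_op_def c_def by blast
  define K where "K = (norm R)\<^sup>2 * c\<^sup>2"
  have K: "K \<ge> 0"
    by (simp add: K_def)
  have key: "(norm x)\<^sup>2 \<le> K * (c\<^sup>2 * (norm x)\<^sup>2 - (norm (S x))\<^sup>2)" for x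
  proof -
    have "x = R (c\<^sup>2 *\<^sub>R x - S (S x))"
      using arg_cong[OF R, of "\<lambda>T. blinfun_apply T x"]
      by (simp add: minus_blinfun.rep_eq scaleR_blinfun.rep_eq)
    then have "norm x \<le> norm R * norm (c\<^sup>2 *\<^sub>R x - S (S x))"
      using norm_blinfun[of R "c\<^sup>2 *\<^sub>R x - S (S x)"] by simp
    then have "(norm x)\<^sup>2 \<le> (norm R)\<^sup>2 * (norm (c\<^sup>2 *\<^sub>R x - S (S x)))\<^sup>2"
      using power_mono[of _ _ 2] by (fastforce simp: power_mult_distrib)
    also have "(norm (c\<^sup>2 *\<^sub>R x - S (S x)))\<^sup>2
        = (norm (S (S x)))\<^sup>2 - 2 * c\<^sup>2 * (norm (S x))\<^sup>2 + (c\<^sup>2)\<^sup>2 * (norm x)\<^sup>2"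
      unfolding power2_norm_eq_inner
      using selfadjoint_op_inner[OF S, of "S x" x]
      by (simp add: inner_diff_left inner_diff_right inner_commute power2_eq_square algebra_simps)
    also have "(norm R)\<^sup>2 * \<dots> \<le> (norm R)\<^sup>2 * (c\<^sup>2 * (c\<^sup>2 * (norm x)\<^sup>2 - (norm (S x))\<^sup>2))"
    proof -
      have "(norm (S (S x)))\<^sup>2 \<le> (c * norm (S x))\<^sup>2"
        unfolding c_def by (intro power_mono norm_blinfun) auto
      then show ?thesis
        by (intro mult_left_mono) (simp_all add: power_mult_distrib power2_eq_square algebra_simps)
    qed
    finally show ?thesis
      by (simp add: K_def mult.assoc)
  qed
  have contract: "(norm (S x))\<^sup>2 \<le> (c\<^sup>2 - 1 / (K + 1)) * (norm x)\<^sup>2" for x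
  proof -
    have "(norm (S x))\<^sup>2 \<le> c\<^sup>2 * (norm x)\<^sup>2"
      using power_mono[OF norm_blinfun[of S x], of 2] by (simp add: c_def power_mult_distrib)
    then have "(norm x)\<^sup>2 \<le> (K + 1) * (c\<^sup>2 * (norm x)\<^sup>2 - (norm (S x))\<^sup>2)"
      using key[of x] by (simp add: algebra_simps)
    then show ?thesis
      using K by (simp add: field_simps)
  qed
  \<comment> \<open>The maximum with 0 allows a square root to be taken even when \<open>c\<^sup>2 - 1 / (K + 1)\<close> is negative,
    in which case the space is trivial.\<close>
  define d where "d = max 0 (c\<^sup>2 - 1 / (K + 1))"
  have "norm (S x) \<le> sqrt d * norm x" for x
  proof (rule power2_le_imp_le)
    have "(c\<^sup>2 - 1 / (K + 1)) * (norm x)\<^sup>2 \<le> d * (norm x)\<^sup>2"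
      by (intro mult_right_mono) (auto simp: d_def)
    with contract[of x] show "(norm (S x))\<^sup>2 \<le> (sqrt d * norm x)\<^sup>2"
      by (simp add: power_mult_distrib d_def)
  qed (simp add: d_def)
  then have "c \<le> sqrt d"
    unfolding c_def by (intro norm_blinfun_bound) (auto simp: d_def)
  then have "c\<^sup>2 \<le> d"
    using real_le_rsqrt[of c d] power_mono[of c "sqrt d" 2] by (simp add: c_def d_def)
  moreover have "1 / (K + 1) > 0"
    using K by simp
  ultimately have "c\<^sup>2 \<le> 0"
    by (auto simp: d_def max_def split: if_splits)
  then show ?thesis
    by (simp add: c_def)
qed

text \<open>
  If \<open>S = p(A)\<close> is nonzero, its norm is a value of \<open>\<bar>p\<bar>\<close> on the spectrum of \<open>A\<close>:
  \<open>\<parallel>S\<parallel>\<^sup>2 - S\<^sup>2\<close> is the value at \<open>A\<close>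
  of the polynomial \<open>\<parallel>S\<parallel>\<^sup>2 - p\<^sup>2\<close> and is not invertible, so this polynomial has a zero in the
  spectrum.
\<close>

lemma norm_op_poly_le:
  fixes A :: "'a :: chilbert_space \<Rightarrow>\<^sub>L 'a"
  assumes A: "selfadjoint_op A" and "0 \<le> K"
    and K: "\<And>t. t \<in> real_spectrum A \<Longrightarrow> \<bar>poly p t\<bar> \<le> K"
  shows "norm (op_poly p A) \<le> K"
proof (cases "op_poly p A = 0")
  case False
  let ?defect = "\<lambda>p. [:(norm (op_poly p A))\<^sup>2:] - p * p"
  have zero: "\<exists>t\<in>real_spectrum A. poly (?defect p) t = 0"
    if "op_poly p A \<noteq> 0" "?defect p \<noteq> 0" for p
  proof (rule ccontr)
    assume "\<not> ?thesis"
    then have "invertible_op (op_poly (?defect p) A)"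
      using that(2) by (intro invertible_op_poly[OF A]) blast+
    then have "invertible_op ((norm (op_poly p A))\<^sup>2 *\<^sub>R id_blinfun - (op_poly p A o\<^sub>L op_poly p A))"
      by (simp add: op_poly_diff op_poly_mult op_poly_pCons)
    then show False
      using not_invertible_norm_square[OF selfadjoint_op_poly[OF A]] that(1) by blast
  qed
  have "\<exists>t\<in>real_spectrum A. poly (?defect p) t = 0"
  proof (cases "?defect p = 0")
    case True
    \<comment> \<open>Then \<open>\<bar>p\<bar>\<close> is the constant \<open>\<parallel>S\<parallel>\<close> and any spectral point is a zero; one exists by the same
      argument applied to the polynomial \<open>X\<close>, since both \<open>A = 0\<close> and the invertibility of \<open>A\<close> would
      follow from an empty spectrum, and then the space would be trivial and \<open>S\<close> zero.\<close>
    have "real_spectrum A \<noteq> {}"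
    proof
      assume empty: "real_spectrum A = {}"
      have "?defect [:0, 1:] \<noteq> 0"
        by simp
      with zero[of "[:0, 1:]"] empty have "op_poly [:0, 1:] A = 0"
        by blast
      moreover have "invertible_op (op_poly [:0, 1:] A)"
        using empty by (intro invertible_op_poly[OF A]) auto
      ultimately have "(id_blinfun :: 'a \<Rightarrow>\<^sub>L 'a) = 0"
        by (auto simp: invertible_op_def)
      then have "x = 0" for x :: 'a
        by (metis blinfun_apply_id_blinfun id_apply zero_blinfun.rep_eq)
      then have "op_poly p A = 0"
        by (intro blinfun_eqI) metis
      with False show False ..
    qed
    with True show ?thesis
      by auto
  qed (use zero False in blast)
  then obtain t where t: "t \<in> real_spectrum A" "(poly p t)\<^sup>2 = (norm (op_poly p A))\<^sup>2"
    by (auto simp: power2_eq_square)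
  then have "norm (op_poly p A) = \<bar>poly p t\<bar>"
    by (metis abs_norm_cancel power2_eq_iff abs_minus_cancel)
  then show ?thesis
    using K[OF t(1)] by simp
qed (use \<open>0 \<le> K\<close> in simp)

section \<open>Continuous functional calculus\<close>

lemma ex_polynomials_uniform_limit:
  fixes f :: "real \<Rightarrow> real"
  assumes "compact S" "continuous_on S f"
  obtains p where "uniform_limit S (\<lambda>n. poly (p n)) f sequentially"
proof -
  obtain g where lim: "uniform_limit S g f sequentially" and g: "\<And>n. polynomial_function (g n)"
    using Stone_Weierstrass_uniform_limit[OF assms] by blast
  have "\<exists>p. g n = poly p" for n
  proof -
    obtain a k where "g n = (\<lambda>x. \<Sum>i\<le>k. a i * x ^ i)"
      using g[of n] by (auto simp: real_polynomial_function_eq[symmetric] real_polynomial_function_iff_sum)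
    then have "g n = poly (\<Sum>i\<le>k. monom (a i) i)"
      by (simp add: fun_eq_iff poly_sum poly_monom)
    then show ?thesis ..
  qed
  then obtain p where "\<And>n. g n = poly (p n)"
    by metis
  then have "g = (\<lambda>n. poly (p n))"
    by (rule ext)
  with lim that show ?thesis
    by blast
qed

text \<open>
  Applied to one sequence twice this is the Cauchy property of \<open>p\<^sub>n(A)\<close>, and applied to two
  sequences it says that their limits agree. Both come from the spectral bound on \<open>p\<^sub>m - q\<^sub>n\<close>.
\<close>

lemma op_poly_uniform_close:
  assumes A: "selfadjoint_op A"
    and p: "uniform_limit (real_spectrum A) (\<lambda>n. poly (p n)) f sequentially"
    and q: "uniform_limit (real_spectrum A) (\<lambda>n. poly (q n)) f sequentially"
    and "0 < e"
  obtains N where "\<And>m n. N \<le> m \<Longrightarrow> N \<le> n \<Longrightarrow> dist (op_poly (p m) A) (op_poly (q n) A) < e"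
proof -
  obtain N1 where N1: "\<And>n t. N1 \<le> n \<Longrightarrow> t \<in> real_spectrum A \<Longrightarrow> dist (poly (p n) t) (f t) < e / 4"
    using p \<open>0 < e\<close> unfolding uniform_limit_sequentially_iff
    by (metis zero_less_divide_iff zero_less_numeral)
  obtain N2 where N2: "\<And>n t. N2 \<le> n \<Longrightarrow> t \<in> real_spectrum A \<Longrightarrow> dist (poly (q n) t) (f t) < e / 4"
    using q \<open>0 < e\<close> unfolding uniform_limit_sequentially_iff
    by (metis zero_less_divide_iff zero_less_numeral)
  have "dist (op_poly (p m) A) (op_poly (q n) A) < e" if "max N1 N2 \<le> m" "max N1 N2 \<le> n" for m n
  proof -
    have "norm (op_poly (p m - q n) A) \<le> e / 2"
    proof (rule norm_op_poly_le[OF A])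
      fix t assume "t \<in> real_spectrum A"
      then have "\<bar>poly (p m) t - f t\<bar> < e / 4" "\<bar>poly (q n) t - f t\<bar> < e / 4"
        using N1[of m t] N2[of n t] that by (auto simp: dist_real_def)
      then show "\<bar>poly (p m - q n) t\<bar> \<le> e / 2"
        unfolding poly_diff by linarith
    qed (use \<open>0 < e\<close> in simp)
    with \<open>0 < e\<close> show ?thesis
      by (simp add: dist_norm op_poly_diff)
  qed
  then show thesis
    by (rule that)
qed

text \<open>
  As soon as one sequence of polynomials approximates \<open>f\<close> uniformly on the spectrum, the
  definite description in the definition of \<open>op_fun\<close> has a unique solution.
\<close>

lemma op_fun_tendsto:
  assumes A: "selfadjoint_op A"
    and p: "uniform_limit (real_spectrum A) (\<lambda>n. poly (p n)) f sequentially"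
  shows "(\<lambda>n. op_poly (p n) A) \<longlonglongrightarrow> op_fun f A"
proof -
  have "Cauchy (\<lambda>n. op_poly (p n) A)"
  proof (rule metric_CauchyI)
    fix e :: real assume "0 < e"
    then show "\<exists>N. \<forall>m\<ge>N. \<forall>n\<ge>N. dist (op_poly (p m) A) (op_poly (p n) A) < e"
      using op_poly_uniform_close[OF A p p] by metis
  qed
  then obtain T where T: "(\<lambda>n. op_poly (p n) A) \<longlonglongrightarrow> T"
    using Cauchy_convergent_iff convergent_def by blast
  have all: "(\<lambda>n. op_poly (q n) A) \<longlonglongrightarrow> T"
    if q: "uniform_limit (real_spectrum A) (\<lambda>n. poly (q n)) f sequentially" for q
  proof -
    have "(\<lambda>n. dist (op_poly (q n) A) (op_poly (p n) A)) \<longlonglongrightarrow> 0"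
    proof (rule metric_LIMSEQ_I)
      fix e :: real assume "0 < e"
      then show "\<exists>N. \<forall>n\<ge>N. dist (dist (op_poly (q n) A) (op_poly (p n) A)) 0 < e"
        using op_poly_uniform_close[OF A q p] by (metis abs_of_nonneg dist_0_norm dist_commute
            real_norm_def zero_le_dist)
    qed
    then have "(\<lambda>n. op_poly (q n) A - op_poly (p n) A) \<longlonglongrightarrow> 0"
      by (simp add: dist_norm tendsto_norm_zero_iff)
    from tendsto_add[OF this T] show ?thesis
      by simp
  qed
  have "op_fun f A = T"
    unfolding op_fun_def
  proof (rule the_equality)
    show "T' = T" if "\<forall>p. uniform_limit (real_spectrum A) (\<lambda>n. poly (p n)) f sequentially \<longrightarrow>
        (\<lambda>n. op_poly (p n) A) \<longlonglongrightarrow> T'" for T'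
      using that p T LIMSEQ_unique by blast
  qed (use all in blast)
  with T show ?thesis
    by simp
qed

lemma op_fun_poly:
  assumes "selfadjoint_op A"
  shows "op_fun (poly p) A = op_poly p A"
proof (rule LIMSEQ_unique)
  show "(\<lambda>n. op_poly p A) \<longlonglongrightarrow> op_fun (poly p) A"
    by (rule op_fun_tendsto[OF assms]) (rule uniform_limit_const)
qed simp

text \<open>
  On an interval \<open>[a, b]\<close> containing the spectrum the polynomial approximations can be taken from
  the Weierstrass theorem; this is why the functional calculus below is set up for functions
  continuous on the whole interval.
\<close>

locale op_between =
  fixes A :: "'a :: chilbert_space \<Rightarrow>\<^sub>L 'a" and a b :: real
  assumes lower: "a *\<^sub>R id_blinfun \<preceq> A" and upper: "A \<preceq> b *\<^sub>R id_blinfun"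
begin

lemma selfadjoint: "selfadjoint_op A"
  using lower by (simp add: op_le_def)

lemma approximation:
  assumes "continuous_on {a..b} f"
  obtains p where "uniform_limit {a..b} (\<lambda>n. poly (p n)) f sequentially"
    "(\<lambda>n. op_poly (p n) A) \<longlonglongrightarrow> op_fun f A"
proof -
  obtain p where p: "uniform_limit {a..b} (\<lambda>n. poly (p n)) f sequentially"
    using ex_polynomials_uniform_limit[OF compact_Icc assms] by blast
  then have "uniform_limit (real_spectrum A) (\<lambda>n. poly (p n)) f sequentially"
    by (rule uniform_limit_on_subset) (rule real_spectrum_subset[OF lower upper])
  then show thesis
    using that p op_fun_tendsto[OF selfadjoint] by blast
qed

lemma op_fun_eqI:
  assumes "uniform_limit {a..b} (\<lambda>n. poly (p n)) f sequentially"
    "(\<lambda>n. op_poly (p n) A) \<longlonglongrightarrow> T"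
  shows "op_fun f A = T"
  using op_fun_tendsto[OF selfadjoint
      uniform_limit_on_subset[OF assms(1) real_spectrum_subset[OF lower upper]]] assms(2)
  by (rule LIMSEQ_unique)

lemma op_fun_cong:
  assumes "continuous_on {a..b} f" "\<And>t. t \<in> {a..b} \<Longrightarrow> f t = g t"
  shows "op_fun f A = op_fun g A"
proof -
  obtain p where p: "uniform_limit {a..b} (\<lambda>n. poly (p n)) f sequentially"
    "(\<lambda>n. op_poly (p n) A) \<longlonglongrightarrow> op_fun f A"
    using approximation[OF assms(1)] .
  moreover have "uniform_limit {a..b} (\<lambda>n. poly (p n)) g sequentially"
    using p(1) assms(2) uniform_limit_cong'[of "{a..b}" "\<lambda>n. poly (p n)" "\<lambda>n. poly (p n)" f g]
    by blast
  ultimately show ?thesis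
    by (metis op_fun_eqI)
qed

lemma op_fun_mult:
  assumes f: "continuous_on {a..b} f" and g: "continuous_on {a..b} g"
  shows "op_fun (\<lambda>t. f t * g t) A = op_fun f A o\<^sub>L op_fun g A"
proof -
  obtain p where p: "uniform_limit {a..b} (\<lambda>n. poly (p n)) f sequentially"
    "(\<lambda>n. op_poly (p n) A) \<longlonglongrightarrow> op_fun f A"
    using approximation[OF f] .
  obtain q where q: "uniform_limit {a..b} (\<lambda>n. poly (q n)) g sequentially"
    "(\<lambda>n. op_poly (q n) A) \<longlonglongrightarrow> op_fun g A"
    using approximation[OF g] .
  show ?thesis
  proof (rule op_fun_eqI)
    show "uniform_limit {a..b} (\<lambda>n. poly (p n * q n)) (\<lambda>t. f t * g t) sequentially"
      unfolding poly_mult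
      by (intro uniform_lim_mult p q compact_imp_bounded compact_continuous_image f g compact_Icc)
    show "(\<lambda>n. op_poly (p n * q n) A) \<longlonglongrightarrow> (op_fun f A o\<^sub>L op_fun g A)"
      unfolding op_poly_mult by (intro tendsto_intros p q)
  qed
qed

lemma op_fun_add:
  assumes f: "continuous_on {a..b} f" and g: "continuous_on {a..b} g"
  shows "op_fun (\<lambda>t. f t + g t) A = op_fun f A + op_fun g A"
proof -
  obtain p where p: "uniform_limit {a..b} (\<lambda>n. poly (p n)) f sequentially"
    "(\<lambda>n. op_poly (p n) A) \<longlonglongrightarrow> op_fun f A"
    using approximation[OF f] .
  obtain q where q: "uniform_limit {a..b} (\<lambda>n. poly (q n)) g sequentially"
    "(\<lambda>n. op_poly (q n) A) \<longlonglongrightarrow> op_fun g A"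
    using approximation[OF g] .
  show ?thesis
  proof (rule op_fun_eqI)
    show "uniform_limit {a..b} (\<lambda>n. poly (p n + q n)) (\<lambda>t. f t + g t) sequentially"
      unfolding poly_add by (intro uniform_limit_intros p q)
    show "(\<lambda>n. op_poly (p n + q n) A) \<longlonglongrightarrow> op_fun f A + op_fun g A"
      unfolding op_poly_add by (intro tendsto_intros p q)
  qed
qed

lemma op_fun_const: "op_fun (\<lambda>t. c) A = c *\<^sub>R id_blinfun"
proof -
  have "poly [:c:] = (\<lambda>t. c)"
    by (simp add: fun_eq_iff)
  then show ?thesis
    using op_fun_poly[OF selfadjoint, of "[:c:]"] by (simp add: op_poly_pCons)
qed

lemma op_fun_id: "op_fun (\<lambda>t. t) A = A"
proof -
  have "poly [:0, 1:] = (\<lambda>t :: real. t)"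
    by (simp add: fun_eq_iff)
  moreover have "op_poly [:0, 1:] A = A"
    by (rule blinfun_eqI) (simp add: op_poly_pCons_apply zero_blinfun.rep_eq)
  ultimately show ?thesis
    using op_fun_poly[OF selfadjoint, of "[:0, 1:]"] by simp
qed

lemma op_fun_scaleR:
  assumes "continuous_on {a..b} f"
  shows "op_fun (\<lambda>t. c * f t) A = c *\<^sub>R op_fun f A"
  using op_fun_mult[OF continuous_on_const assms, of c]
  by (auto simp: op_fun_const scaleR_blinfun.rep_eq intro!: blinfun_eqI)

lemma selfadjoint_op_fun:
  assumes "continuous_on {a..b} f"
  shows "selfadjoint_op (op_fun f A)"
proof -
  obtain p where "(\<lambda>n. op_poly (p n) A) \<longlonglongrightarrow> op_fun f A"
    using approximation[OF assms] by blast
  then show ?thesis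
    using selfadjoint_op_limit[OF selfadjoint_op_poly[OF selfadjoint]] by blast
qed

text \<open>
  \<open>g(A) - f(A)\<close> is the square of the selfadjoint operator \<open>r(A)\<close> with \<open>r = sqrt (g - f)\<close>.
\<close>

lemma op_fun_mono:
  assumes f: "continuous_on {a..b} f" and g: "continuous_on {a..b} g"
    and le: "\<And>t. t \<in> {a..b} \<Longrightarrow> f t \<le> g t"
  shows "op_fun f A \<preceq> op_fun g A"
proof -
  let ?r = "\<lambda>t. sqrt (g t - f t)"
  have r: "continuous_on {a..b} ?r"
    using f g by (intro continuous_intros)
  have "op_fun g A = op_fun (\<lambda>t. f t + ?r t * ?r t) A"
    using g le by (intro op_fun_cong) auto
  also have "\<dots> = op_fun f A + (op_fun ?r A o\<^sub>L op_fun ?r A)"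
    using op_fun_add[OF f continuous_on_mult[OF r r]] op_fun_mult[OF r r] by simp
  finally have "inner (op_fun g A x) x = inner (op_fun f A x) x + (norm (op_fun ?r A x))\<^sup>2" for x
    by (simp add: plus_blinfun.rep_eq inner_add_left power2_norm_eq_inner
        selfadjoint_op_inner[OF selfadjoint_op_fun[OF r]])
  then have "inner (op_fun f A x) x \<le> inner (op_fun g A x) x" for x
    by simp
  then show ?thesis
    using selfadjoint_op_fun f g by (simp add: op_le_iff_inner)
qed

end

section \<open>Real powers of an operator\<close>

context op_between
begin

lemma selfadjoint_op_powr: "0 < a \<Longrightarrow> selfadjoint_op (op_powr A r)"
  unfolding op_powr_def by (intro selfadjoint_op_fun continuous_intros) auto

lemma op_powr_add:
  assumes "0 < a"
  shows "op_powr A r o\<^sub>L op_powr A s = op_powr A (r + s)"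
proof -
  have "continuous_on {a..b} (\<lambda>t. t powr r)" for r
    using assms by (intro continuous_intros) auto
  then show ?thesis
    unfolding op_powr_def powr_add by (intro op_fun_mult[symmetric])
qed

lemma op_powr_0: "0 < a \<Longrightarrow> op_powr A 0 = id_blinfun"
  using op_fun_cong[of "\<lambda>t. 1" "\<lambda>t. t powr 0"] op_fun_const[of 1]
  by (simp add: op_powr_def)

lemma op_powr_1: "0 < a \<Longrightarrow> op_powr A 1 = A"
  using op_fun_cong[of "\<lambda>t. t" "\<lambda>t. t powr 1"] op_fun_id
  by (simp add: op_powr_def)

lemma op_powr_minus_1_bounds:
  assumes "0 < a" "0 < b"
  shows "inverse b *\<^sub>R id_blinfun \<preceq> op_powr A (- 1)"
    and "op_powr A (- 1) \<preceq> inverse a *\<^sub>R id_blinfun"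
proof -
  have "continuous_on {a..b} (\<lambda>t. t powr - 1)"
    using assms by (intro continuous_intros) auto
  moreover have "inverse b \<le> t powr - 1" "t powr - 1 \<le> inverse a" if "t \<in> {a..b}" for t
    using that assms by (auto simp: powr_minus intro!: le_imp_inverse_le)
  ultimately show "inverse b *\<^sub>R id_blinfun \<preceq> op_powr A (- 1)"
    "op_powr A (- 1) \<preceq> inverse a *\<^sub>R id_blinfun"
    unfolding op_powr_def op_fun_const[symmetric]
    by (intro op_fun_mono continuous_on_const; simp)+
qed

end

section \<open>Comparison of the operator means\<close>

text \<open>
  With \<open>P = A^(1/2)\<close>, \<open>Q = P^(-1)\<close> and \<open>X = Q B Q\<close>, the weighted geometric mean is \<open>P X^v P\<close>
  and the weighted harmonic mean is \<open>P h(X) P\<close>, where \<open>h t\<close> is the harmonic mean of the scalars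
  \<open>1\<close> and \<open>t\<close>. The bounds on \<open>A\<close> and \<open>B\<close> put the spectrum of \<open>X\<close> into \<open>[c / b, d / a]\<close>, so a
  comparison of scalar means on this interval passes to \<open>X\<close> by monotonicity of the functional
  calculus and from there to the operator means by sandwiching with \<open>P\<close>.
\<close>

lemma op_harm_mean_bounds:
  fixes A B :: "'a :: chilbert_space \<Rightarrow>\<^sub>L 'a" and a b c d k K v :: real
  assumes A: "a *\<^sub>R id_blinfun \<preceq> A" "A \<preceq> b *\<^sub>R id_blinfun"
    and B: "c *\<^sub>R id_blinfun \<preceq> B" "B \<preceq> d *\<^sub>R id_blinfun"
    and pos: "0 < a" "0 < b" "0 < c" "0 < d" and v: "0 \<le> v" "v \<le> 1"
    and scalar: "\<And>t. c / b \<le> t \<Longrightarrow> t \<le> d / a \<Longrightarrow>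
      k * t powr v \<le> harm_mean v 1 t \<and> harm_mean v 1 t \<le> K * t powr v"
  shows "k *\<^sub>R op_geo_mean v A B \<preceq> op_harm_mean v A B"
    and "op_harm_mean v A B \<preceq> K *\<^sub>R op_geo_mean v A B"
proof -
  interpret A: op_between A a b
    using A by unfold_locales
  define P where "P = op_powr A (1/2)"
  define Q where "Q = op_powr A (- (1/2))"
  have sa: "selfadjoint_op P" "selfadjoint_op Q"
    using A.selfadjoint_op_powr pos by (simp_all add: P_def Q_def)
  have "P o\<^sub>L Q = id_blinfun" "Q o\<^sub>L P = id_blinfun" "P o\<^sub>L P = A"
    and QQ: "Q o\<^sub>L Q = op_powr A (- 1)"
    using pos by (simp_all add: P_def Q_def A.op_powr_add A.op_powr_0 A.op_powr_1)
  then have PQ: "P (Q x) = x" "Q (P x) = x" and PP: "P (P x) = A x" for x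
    by (metis blinfun_apply_blinfun_compose blinfun_apply_id_blinfun id_apply)+
  define X where "X = Q o\<^sub>L B o\<^sub>L Q"
  have X_le: "Q o\<^sub>L (c *\<^sub>R id_blinfun) o\<^sub>L Q \<preceq> X" "X \<preceq> Q o\<^sub>L (d *\<^sub>R id_blinfun) o\<^sub>L Q"
    unfolding X_def using sa B by (auto intro: op_le_sandwich)
  have Q_apply: "Q o\<^sub>L (r *\<^sub>R id_blinfun) o\<^sub>L Q = r *\<^sub>R op_powr A (- 1)" for r
    unfolding QQ[symmetric]
    by (rule blinfun_eqI) (simp add: scaleR_blinfun.rep_eq blinfun.scaleR_right)
  interpret X: op_between X "c / b" "d / a"
  proof
    show "(c / b) *\<^sub>R id_blinfun \<preceq> X"
      using op_le_trans[OF op_le_scaleR[OF _ A.op_powr_minus_1_bounds(1)], of c X]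
        X_le(1) pos by (simp add: Q_apply divide_inverse)
    show "X \<preceq> (d / a) *\<^sub>R id_blinfun"
      using op_le_trans[OF _ op_le_scaleR[OF _ A.op_powr_minus_1_bounds(2)], of X d]
        X_le(2) pos by (simp add: Q_apply divide_inverse)
  qed
  have pos_t: "0 < t" if "t \<in> {c / b..d / a}" for t
    using that pos less_le_trans[of 0 "c / b" t] by simp
  define w where "w = (\<lambda>t. (1 - v) + v * t powr - 1)"
  have w_pos: "0 < w t" if "t \<in> {c / b..d / a}" for t
  proof (cases "v = 0")
    case False
    then have "0 < v * t powr - 1"
      using v pos_t[OF that] by simp
    then show ?thesis
      using v by (simp add: w_def add_nonneg_pos)
  qed (simp add: w_def)
  have cont_powr: "continuous_on {c / b..d / a} (\<lambda>t. t powr r)" for r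
    using pos_t by (intro continuous_intros) force+
  have cont_w: "continuous_on {c / b..d / a} w"
    unfolding w_def by (intro continuous_intros cont_powr)
  have harm_mean_eq: "harm_mean v 1 t = inverse (w t)" if "t \<in> {c / b..d / a}" for t
    using pos_t[OF that] by (simp add: harm_mean_def w_def powr_minus)
  have cont_h: "continuous_on {c / b..d / a} (harm_mean v 1)"
  proof (subst continuous_on_cong[OF refl harm_mean_eq])
    show "continuous_on {c / b..d / a} (\<lambda>t. inverse (w t))"
      using cont_w w_pos by (intro continuous_on_inverse) force+
  qed
  \<comment> \<open>\<open>W\<close> and \<open>H\<close> are mutually inverse: they come from the reciprocal functions \<open>w\<close> and \<open>h\<close>.\<close>
  define W where "W = op_fun w X"
  define H where "H = op_fun (harm_mean v 1) X"
  have W_eq: "W = (1 - v) *\<^sub>R id_blinfun + v *\<^sub>R op_powr X (- 1)"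
    unfolding W_def w_def op_powr_def
    by (simp only: X.op_fun_add[OF continuous_on_const continuous_on_mult_left[OF cont_powr]]
        X.op_fun_const X.op_fun_scaleR[OF cont_powr])
  have "op_fun (\<lambda>t. w t * harm_mean v 1 t) X = id_blinfun"
    "op_fun (\<lambda>t. harm_mean v 1 t * w t) X = id_blinfun"
    using X.op_fun_const[of 1]
      X.op_fun_cong[of "\<lambda>t. w t * harm_mean v 1 t" "\<lambda>t. 1"]
      X.op_fun_cong[of "\<lambda>t. harm_mean v 1 t * w t" "\<lambda>t. 1"] cont_w cont_h
    using w_pos by (force simp: harm_mean_eq intro!: continuous_on_mult)+
  then have "W o\<^sub>L H = id_blinfun" "H o\<^sub>L W = id_blinfun"
    by (simp_all add: W_def H_def X.op_fun_mult cont_w cont_h)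
  then have WH: "W (H x) = x" "H (W x) = x" for x
    by (metis blinfun_apply_blinfun_compose blinfun_apply_id_blinfun id_apply)+

  have inv_A: "inverse_op A = Q o\<^sub>L Q"
    by (rule inverse_op_eqI) (auto intro!: blinfun_eqI simp: PP[symmetric] PQ)
  have inv_B: "inverse_op B = Q o\<^sub>L op_powr X (- 1) o\<^sub>L Q"
  proof -
    have Xpos: "0 < c / b"
      using pos by simp
    have "X o\<^sub>L op_powr X (- 1) = op_powr X (1 + - 1)" "op_powr X (- 1) o\<^sub>L X = op_powr X (- 1 + 1)"
      using X.op_powr_add[OF Xpos, of 1 "- 1"] X.op_powr_add[OF Xpos, of "- 1" 1]
      by (simp_all add: X.op_powr_1[OF Xpos])
    then have "X o\<^sub>L op_powr X (- 1) = id_blinfun" "op_powr X (- 1) o\<^sub>L X = id_blinfun"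
      by (simp_all add: X.op_powr_0[OF Xpos])
    then have XX: "X (op_powr X (- 1) x) = x" "op_powr X (- 1) (X x) = x" for x
      by (metis blinfun_apply_blinfun_compose blinfun_apply_id_blinfun id_apply)+
    have B_apply: "B x = P (X (P x))" for x
      by (simp add: X_def PQ)
    show ?thesis
      by (rule inverse_op_eqI) (auto intro!: blinfun_eqI simp: B_apply XX PQ)
  qed
  have "(1 - v) *\<^sub>R inverse_op A + v *\<^sub>R inverse_op B = Q o\<^sub>L W o\<^sub>L Q"
    by (rule blinfun_eqI)
      (simp add: inv_A inv_B W_eq plus_blinfun.rep_eq scaleR_blinfun.rep_eq blinfun.add_right
        blinfun.scaleR_right)
  then have harm: "op_harm_mean v A B = P o\<^sub>L H o\<^sub>L P"
    unfolding op_harm_mean_def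
    by simp (rule inverse_op_eqI; auto intro!: blinfun_eqI simp: PQ WH)
  have geo: "r *\<^sub>R op_geo_mean v A B = P o\<^sub>L op_fun (\<lambda>t. r * t powr v) X o\<^sub>L P" for r
    unfolding op_geo_mean_def P_def[symmetric] Q_def[symmetric] X_def[symmetric]
    by (rule blinfun_eqI)
      (simp add: X.op_fun_scaleR[OF cont_powr] op_powr_def scaleR_blinfun.rep_eq blinfun.scaleR_right)
  show "k *\<^sub>R op_geo_mean v A B \<preceq> op_harm_mean v A B"
    unfolding harm geo H_def using scalar
    by (intro op_le_sandwich sa X.op_fun_mono cont_h continuous_on_mult_left cont_powr) simp
  show "op_harm_mean v A B \<preceq> K *\<^sub>R op_geo_mean v A B"
    unfolding harm geo H_def using scalar
    by (intro op_le_sandwich sa X.op_fun_mono cont_h continuous_on_mult_left cont_powr) simp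
qed

section \<open>The ratio of the scalar means\<close>

text \<open>
  The quotient of the geometric by the harmonic mean of \<open>1\<close> and \<open>t\<close>. By homogeneity it determines
  the quotient for \<open>a\<close> and \<open>b\<close> through \<open>t = b / a\<close>.
\<close>

definition mean_ratio :: "real \<Rightarrow> real \<Rightarrow> real"
  where "mean_ratio v t = (1 - v) * t powr v + v * t powr (v - 1)"

lemma mean_ratio_pos:
  assumes "0 \<le> v" "v \<le> 1" "0 < t"
  shows "0 < mean_ratio v t"
proof (cases "v = 0")
  case False
  then have "0 < v * t powr (v - 1)" "0 \<le> (1 - v) * t powr v"
    using assms by auto
  then show ?thesis
    unfolding mean_ratio_def by linarith
qed (use assms in \<open>simp add: mean_ratio_def\<close>)

lemma harm_mean_div_geo_mean:
  assumes "0 < a" "0 < b"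
  shows "harm_mean v a b / geo_mean v a b = inverse (mean_ratio v (b / a))"
proof -
  have "((1 - v) * inverse a + v * inverse b) * (a powr (1 - v) * b powr v) = mean_ratio v (b / a)"
    using assms by (simp add: mean_ratio_def powr_divide powr_diff field_simps)
  then show ?thesis
    by (simp add: harm_mean_def geo_mean_def divide_inverse flip: inverse_mult_distrib)
qed

text \<open>
  The derivative \<open>v (1 - v) t^(v - 2) (t - 1)\<close> has the sign of \<open>t - 1\<close>.
\<close>

lemma mean_ratio_mono:
  assumes v: "0 \<le> v" "v \<le> 1" and "1 \<le> s" "s \<le> t"
  shows "mean_ratio v s \<le> mean_ratio v t"
proof (rule DERIV_nonneg_imp_nondecreasing[OF \<open>s \<le> t\<close>])
  fix x assume "s \<le> x" "x \<le> t"
  then have x: "1 \<le> x"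
    using assms by simp
  let ?D = "(1 - v) * (v * x powr (v - 1)) + v * ((v - 1) * x powr (v - 1 - 1))"
  have "(mean_ratio v has_real_derivative ?D) (at x)"
    unfolding mean_ratio_def[abs_def] using x by (auto intro!: derivative_eq_intros)
  moreover have "?D = v * (1 - v) * (x powr (v - 1) - x powr (v - 1 - 1))"
    by (simp add: algebra_simps)
  moreover have "x powr (v - 1 - 1) \<le> x powr (v - 1)"
    using x by (intro powr_mono) auto
  ultimately show "\<exists>D. (mean_ratio v has_real_derivative D) (at x) \<and> 0 \<le> D"
    using v by (intro exI[of _ ?D]) auto
qed

text \<open>
  Exchanging the two arguments of a mean exchanges the weights \<open>v\<close> and \<open>1 - v\<close>. This turns
  monotonicity on \<open>[1, \<infinity>)\<close> into antimonotonicity on \<open>(0, 1]\<close>.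
\<close>

lemma mean_ratio_inverse: "0 < t \<Longrightarrow> mean_ratio v (inverse t) = mean_ratio (1 - v) t"
  by (simp add: mean_ratio_def powr_minus inverse_powr flip: powr_minus)

lemma mean_ratio_antimono:
  assumes v: "0 \<le> v" "v \<le> 1" and "0 < s" "s \<le> t" "t \<le> 1"
  shows "mean_ratio v t \<le> mean_ratio v s"
proof -
  have "mean_ratio (1 - v) (inverse t) \<le> mean_ratio (1 - v) (inverse s)"
    using assms by (intro mean_ratio_mono le_imp_inverse_le) (auto simp: one_le_inverse_iff)
  then show ?thesis
    using assms mean_ratio_inverse[of "inverse t" v] mean_ratio_inverse[of "inverse s" v] by simp
qed

lemma harm_mean_bounds:
  assumes "0 \<le> v" "v \<le> 1" "0 < t"
    and "0 < a" "0 < b" "mean_ratio v t \<le> mean_ratio v (b / a)"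
    and "0 < c" "0 < d" "mean_ratio v (d / c) \<le> mean_ratio v t"
  shows "harm_mean v a b / geo_mean v a b * t powr v \<le> harm_mean v 1 t \<and>
    harm_mean v 1 t \<le> harm_mean v c d / geo_mean v c d * t powr v"
proof -
  have "harm_mean v 1 t = inverse (mean_ratio v t) * t powr v"
    using harm_mean_div_geo_mean[of 1 t v] assms by (simp add: geo_mean_def field_simps)
  moreover have "inverse (mean_ratio v (b / a)) \<le> inverse (mean_ratio v t)"
    "inverse (mean_ratio v t) \<le> inverse (mean_ratio v (d / c))"
    using assms mean_ratio_pos by (auto intro!: le_imp_inverse_le)
  ultimately show ?thesis
    using assms by (simp add: harm_mean_div_geo_mean mult_right_mono)
qed

theorem corollary2p2:
  fixes A B :: "'a :: chilbert_space \<Rightarrow>\<^sub>L 'a"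
    and m m' M M' v :: real
  assumes "strictly_positive_op A" and "strictly_positive_op B"
    and "0 < m" and "0 < m'" and "0 < M" and "0 < M'"
    and "0 \<le> v" and "v \<le> 1"
  shows
    "(m' *\<^sub>R id_blinfun \<preceq> A \<and> A \<preceq> m *\<^sub>R id_blinfun \<and> m < M \<and>
      M *\<^sub>R id_blinfun \<preceq> B \<and> B \<preceq> M' *\<^sub>R id_blinfun \<longrightarrow>
        (harm_mean v m' M' / geo_mean v m' M') *\<^sub>R op_geo_mean v A B \<preceq> op_harm_mean v A B \<and>
        op_harm_mean v A B \<preceq> (harm_mean v m M / geo_mean v m M) *\<^sub>R op_geo_mean v A B)
     \<and>
     (m' *\<^sub>R id_blinfun \<preceq> B \<and> B \<preceq> m *\<^sub>R id_blinfun \<and> m < M \<and>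
      M *\<^sub>R id_blinfun \<preceq> A \<and> A \<preceq> M' *\<^sub>R id_blinfun \<longrightarrow>
        (harm_mean v M' m' / geo_mean v M' m') *\<^sub>R op_geo_mean v A B \<preceq> op_harm_mean v A B \<and>
        op_harm_mean v A B \<preceq> (harm_mean v M m / geo_mean v M m) *\<^sub>R op_geo_mean v A B)"
proof (intro conjI[of "_ \<longrightarrow> _"] impI; elim conjE)
  assume "m' *\<^sub>R id_blinfun \<preceq> A" "A \<preceq> m *\<^sub>R id_blinfun" "m < M"
    "M *\<^sub>R id_blinfun \<preceq> B" "B \<preceq> M' *\<^sub>R id_blinfun"
  moreover have "harm_mean v m' M' / geo_mean v m' M' * t powr v \<le> harm_mean v 1 t \<and>
      harm_mean v 1 t \<le> harm_mean v m M / geo_mean v m M * t powr v"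
    if "M / m \<le> t" "t \<le> M' / m'" for t
  proof -
    have "1 \<le> M / m"
      using \<open>m < M\<close> assms by simp
    with that have "0 < t" "1 \<le> t"
      by linarith+
    with \<open>1 \<le> M / m\<close> show ?thesis
      using that assms by (intro harm_mean_bounds mean_ratio_mono) auto
  qed
  ultimately show "(harm_mean v m' M' / geo_mean v m' M') *\<^sub>R op_geo_mean v A B \<preceq> op_harm_mean v A B \<and>
      op_harm_mean v A B \<preceq> (harm_mean v m M / geo_mean v m M) *\<^sub>R op_geo_mean v A B"
    using assms op_harm_mean_bounds[of m' A m M B M' v] by blast
next
  assume "m' *\<^sub>R id_blinfun \<preceq> B" "B \<preceq> m *\<^sub>R id_blinfun" "m < M"
    "M *\<^sub>R id_blinfun \<preceq> A" "A \<preceq> M' *\<^sub>R id_blinfun"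
  moreover have "harm_mean v M' m' / geo_mean v M' m' * t powr v \<le> harm_mean v 1 t \<and>
      harm_mean v 1 t \<le> harm_mean v M m / geo_mean v M m * t powr v"
    if "m' / M' \<le> t" "t \<le> m / M" for t
  proof -
    have "0 < m' / M'" "m / M \<le> 1"
      using \<open>m < M\<close> assms by simp_all
    with that have "0 < t" "t \<le> 1"
      by linarith+
    with \<open>0 < m' / M'\<close> \<open>m / M \<le> 1\<close> show ?thesis
      using that assms by (intro harm_mean_bounds mean_ratio_antimono) auto
  qed
  ultimately show "(harm_mean v M' m' / geo_mean v M' m') *\<^sub>R op_geo_mean v A B \<preceq> op_harm_mean v A B \<and>
      op_harm_mean v A B \<preceq> (harm_mean v M m / geo_mean v M m) *\<^sub>R op_geo_mean v A B"
    using assms op_harm_mean_bounds[of M A M' m' B m v] by blast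
qed

end
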